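(* Let $G$ be a finitely generated residually finite group all of whose amenable normal subgroups are finite. For any normal subgroup $N$ of $G$ and any commensurated subgroup $H$ of $G$, if $N \cap H = \{1\}$, then some subgroup of finite index in $H$ commutes with $N$ (i.e. is contained in the centralizer of $N$).
   Context: A subgroup $H$ of a group $G$ is commensurated if $[H : H \cap gHg^{-1}] < \infty$ for all $g \in G$. Groups are abstract (discrete) groups, and amenability is meant in the sense of discrete groups. *)

theory Defs
  imports "HOL-Algebra.Algebra" "HOL-Analysis.Elementary_Metric_Spaces"
begin

text \<open>
  \<open>finite_index_subgroup G H K\<close> means that \<open>K\<close> is a subgroup of the subgroup \<open>H\<close> of \<open>G\<close> with
  \<open>[H : K] < \<infinity>\<close>.
\<close>

definition finite_index_subgroup ::
    "('a, 'b) monoid_scheme \<Rightarrow> 'a set \<Rightarrow> 'a set \<Rightarrow> bool" where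
  "finite_index_subgroup G H K \<longleftrightarrow>
     subgroup K (G\<lparr>carrier := H\<rparr>) \<and> finite (rcosets\<^bsub>G\<lparr>carrier := H\<rparr>\<^esub> K)"

definition commensurated :: "'a set \<Rightarrow> ('a, 'b) monoid_scheme \<Rightarrow> bool" where
  "commensurated H G \<longleftrightarrow> subgroup H G \<and>
     (\<forall>g\<in>carrier G. finite_index_subgroup G H (H \<inter> (g <#\<^bsub>G\<^esub> H #>\<^bsub>G\<^esub> inv\<^bsub>G\<^esub> g)))"

definition finitely_generated_group :: "('a, 'b) monoid_scheme \<Rightarrow> bool" where
  "finitely_generated_group G \<longleftrightarrow>
     group G \<and> (\<exists>S. finite S \<and> S \<subseteq> carrier G \<and> generate G S = carrier G)"

definition residually_finite_group :: "('a, 'b) monoid_scheme \<Rightarrow> bool" where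
  "residually_finite_group G \<longleftrightarrow> group G \<and>
     (\<forall>g\<in>carrier G - {\<one>\<^bsub>G\<^esub>}. \<exists>K. K \<lhd> G \<and> finite_index_subgroup G (carrier G) K \<and> g \<notin> K)"

definition centralizer :: "('a, 'b) monoid_scheme \<Rightarrow> 'a set \<Rightarrow> 'a set" where
  "centralizer G S = {g \<in> carrier G. \<forall>s\<in>S. g \<otimes>\<^bsub>G\<^esub> s = s \<otimes>\<^bsub>G\<^esub> g}"

text \<open>
  A left-invariant mean on the bounded real functions on \<open>carrier G\<close>. Functions are total in HOL,
  but linearity and positivity force \<open>m f\<close> to depend only on the values of \<open>f\<close> on \<open>carrier G\<close>;
  the values of \<open>m\<close> at functions that are unbounded on \<open>carrier G\<close> are irrelevant.
\<close>

definition left_invariant_mean ::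
    "('a, 'b) monoid_scheme \<Rightarrow> (('a \<Rightarrow> real) \<Rightarrow> real) \<Rightarrow> bool" where
  "left_invariant_mean G m \<longleftrightarrow>
     (\<forall>f h. bounded (f ` carrier G) \<longrightarrow> bounded (h ` carrier G) \<longrightarrow>
        m (\<lambda>x. f x + h x) = m f + m h) \<and>
     (\<forall>c f. bounded (f ` carrier G) \<longrightarrow> m (\<lambda>x. c * f x) = c * m f) \<and>
     (\<forall>f. bounded (f ` carrier G) \<longrightarrow> (\<forall>x\<in>carrier G. 0 \<le> f x) \<longrightarrow> 0 \<le> m f) \<and>
     m (\<lambda>x. 1) = 1 \<and>
     (\<forall>g\<in>carrier G. \<forall>f. bounded (f ` carrier G) \<longrightarrow> m (\<lambda>x. f (g \<otimes>\<^bsub>G\<^esub> x)) = m f)"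

definition amenable_group :: "('a, 'b) monoid_scheme \<Rightarrow> bool" where
  "amenable_group G \<longleftrightarrow> group G \<and> (\<exists>m. left_invariant_mean G m)"

end

theory Submission
  imports Defs "HOL-Analysis.Function_Topology" "HOL-Library.Multiset" "HOL-Real_Asymp.Real_Asymp"
begin

text \<open>
  Let \<open>J\<close> be the profinite closure of \<open>H\<close>. It is again commensurated, and since \<open>G\<close> is finitely
  generated and \<open>J\<close> is closed, some normal subgroup \<open>L\<close> of finite index makes \<open>M = J \<inter> L\<close> normal in \<open>G\<close>.
  An element \<open>n \<in> N\<close> centralizes \<open>H \<inter> n H n\<inverse>\<close>, because the commutators lie in \<open>N \<inter> H = 1\<close>; as
  centralizers are closed in a residually finite group, \<open>n\<close> centralizes a subgroup of finite index
  of \<open>J\<close>. Hence all conjugacy classes of the normal subgroup \<open>A = M \<inter> N\<close> are finite, so \<open>A\<close> is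
  amenable and therefore finite, and some normal \<open>L'\<close> of finite index satisfies \<open>A \<inter> L' = 1\<close>. The
  commutators of \<open>H \<inter> L \<inter> L'\<close> with \<open>N\<close> lie in \<open>M \<inter> N \<inter> L' = 1\<close>.

  A group with finite conjugacy classes is amenable because a finite set of \<open>m\<close> generators that is
  stable under conjugation admits at most \<open>(n + 1)\<^sup>m\<close> products of length \<open>n\<close>: polynomial growth
  yields Folner sets, and Tychonoff's theorem yields an invariant mean from averages over them.
\<close>

subsection \<open>Amenability of groups with finite conjugacy classes\<close>

lemma sum_image_diff_bound:
  fixes f :: "'a \<Rightarrow> real"
  assumes "finite E" "inj_on p E" "\<And>x. x \<in> E \<union> p ` E \<Longrightarrow> \<bar>f x\<bar> \<le> B"
  shows "\<bar>(\<Sum>x\<in>E. f (p x)) - (\<Sum>x\<in>E. f x)\<bar> \<le> 2 * B * real (card (p ` E - E))"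
proof -
  let ?D = "p ` E"
  have fin: "finite ?D" using assms by simp
  have card: "card (E - ?D) = card (?D - E)"
    using card_Diff_subset_Int[of E ?D] card_Diff_subset_Int[of ?D E] assms(1) fin card_image[OF assms(2)]
    by (simp add: Int_commute)
  have bound: "\<bar>sum f Y\<bar> \<le> B * real (card Y)" if "Y \<subseteq> E \<union> ?D" for Y
  proof -
    have "\<bar>sum f Y\<bar> \<le> (\<Sum>x\<in>Y. \<bar>f x\<bar>)" by (rule sum_abs)
    also have "\<dots> \<le> (\<Sum>x\<in>Y. B)" using that assms(3) by (intro sum_mono) blast
    finally have "\<bar>sum f Y\<bar> \<le> (\<Sum>x\<in>Y. B)" .
    then show ?thesis by (simp add: mult.commute)
  qed
  have "(\<Sum>x\<in>E. f (p x)) = sum f ?D"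
    using assms(2) by (simp add: sum.reindex)
  also have "\<dots> = sum f (?D - E) + sum f (E \<inter> ?D)"
    using fin by (metis Int_commute add.commute sum.Int_Diff)
  finally have "(\<Sum>x\<in>E. f (p x)) - sum f E = sum f (?D - E) - sum f (E - ?D)"
    using sum.Int_Diff[OF assms(1), of f ?D] by simp
  then show ?thesis
    using bound[of "?D - E", OF le_supI2[OF Diff_subset]] bound[of "E - ?D", OF le_supI1[OF Diff_subset]] card
    by (simp add: abs_le_iff)
qed

text \<open>Averages over Folner sets are means that are nearly invariant for finitely many
  translations and functions. Compactness of a product of intervals turns these approximate
  solutions into an exact one through the finite intersection property.\<close>

theorem (in group) amenable_group_if_Folner:
  assumes folner: "\<And>F \<epsilon>. finite F \<Longrightarrow> F \<subseteq> carrier G \<Longrightarrow> 0 < \<epsilon> \<Longrightarrow>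
      \<exists>E. finite E \<and> E \<noteq> {} \<and> E \<subseteq> carrier G \<and>
        (\<forall>g\<in>F. real (card ((\<lambda>x. g \<otimes> x) ` E - E)) \<le> \<epsilon> * real (card E))"
  shows "amenable_group G"
proof -
  let ?bdd = "\<lambda>f :: 'a \<Rightarrow> real. bounded (f ` carrier G)"
  \<comment> \<open>One bound is fixed for every function at once. It is nonnegative also for
    unbounded \<open>f\<close>, so that each interval \<open>{- B f..B f}\<close> contains
    0.\<close>
  have "\<forall>f. \<exists>B\<ge>0. ?bdd f \<longrightarrow> (\<forall>x\<in>carrier G. \<bar>f x\<bar> \<le> B)"
  proof
    fix f :: "'a \<Rightarrow> real"
    show "\<exists>B\<ge>0. ?bdd f \<longrightarrow> (\<forall>x\<in>carrier G. \<bar>f x\<bar> \<le> B)"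
    proof (cases "?bdd f")
      case True
      then obtain b where "\<forall>x\<in>carrier G. \<bar>f x\<bar> \<le> b" by (auto simp: bounded_iff)
      then show ?thesis by (intro exI[of _ "max 0 b"]) (auto simp: le_max_iff_disj)
    qed auto
  qed
  then obtain B where B: "\<And>f. 0 \<le> B f" "\<And>f x. ?bdd f \<Longrightarrow> x \<in> carrier G \<Longrightarrow> \<bar>f x\<bar> \<le> B f"
    by metis
  have bdd_shift: "?bdd (\<lambda>x. f (g \<otimes> x))" if "?bdd f" "g \<in> carrier G" for f g
    by (rule bounded_subset[OF that(1)]) (use that(2) in auto)
  have bdd_scale: "?bdd (\<lambda>x. c * f x)" if "?bdd f" for c f
  proof -
    have "\<bar>c * f x\<bar> \<le> \<bar>c\<bar> * B f" if "x \<in> carrier G" for x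
      using B(2)[OF \<open>?bdd f\<close> that] by (simp add: abs_mult mult_left_mono)
    then show ?thesis by (auto simp: bounded_iff)
  qed
  have bdd_add: "?bdd (\<lambda>x. f x + h x)" if "?bdd f" "?bdd h" for f h
  proof -
    have "\<bar>f x + h x\<bar> \<le> B f + B h" if "x \<in> carrier G" for x
      using B(2)[OF \<open>?bdd f\<close> that] B(2)[OF \<open>?bdd h\<close> that] by linarith
    then show ?thesis by (auto simp: bounded_iff)
  qed
  \<comment> \<open>\<open>Y\<close> is compact by Tychonoff, \<open>Lin\<close> holds all clauses
    of a left-invariant mean except invariance, and \<open>I\<close> relaxes a single instance of
    invariance to a tolerance. Splitting invariance this way gives the family for the finite
    intersection property.\<close>
  define Y where "Y = {m :: ('a \<Rightarrow> real) \<Rightarrow> real. \<forall>f. m f \<in> {- B f..B f}}"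
  define Lin where "Lin = {m :: ('a \<Rightarrow> real) \<Rightarrow> real.
     (\<forall>f h. ?bdd f \<longrightarrow> ?bdd h \<longrightarrow> m (\<lambda>x. f x + h x) = m f + m h) \<and>
     (\<forall>c f. ?bdd f \<longrightarrow> m (\<lambda>x. c * f x) = c * m f) \<and>
     (\<forall>f. ?bdd f \<longrightarrow> (\<forall>x\<in>carrier G. 0 \<le> f x) \<longrightarrow> 0 \<le> m f) \<and>
     m (\<lambda>x. 1) = 1}"
  define I where "I = (\<lambda>(g, f, \<epsilon>). {m :: ('a \<Rightarrow> real) \<Rightarrow> real. \<bar>m (\<lambda>x. f (g \<otimes> x)) - m f\<bar> \<le> (\<epsilon> :: real)})"
  define P where "P = carrier G \<times> {f. ?bdd f} \<times> {\<epsilon>. (0::real) < \<epsilon>}"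
  \<comment> \<open>Evaluation at \<open>f\<close> is a coordinate projection of the product, which
    makes every clause of \<open>Lin\<close> and \<open>I\<close> a closed condition.\<close>
  have cont: "continuous_on UNIV (\<lambda>m :: ('a \<Rightarrow> real) \<Rightarrow> real. m f)" for f
    by (rule continuous_on_product_coordinates)
  have "compactin (product_topology (\<lambda>_. euclideanreal) UNIV) (PiE UNIV (\<lambda>f. {- B f..B f}))"
    by (subst compactin_PiE) auto
  moreover have "PiE UNIV (\<lambda>f. {- B f..B f}) = Y"
    by (auto simp: Y_def PiE_UNIV_domain)
  ultimately have "compact Y"
    by (simp add: euclidean_product_topology)
  moreover have "closed Lin"
    unfolding Lin_def
    by (intro closed_Collect_conj closed_Collect_all closed_Collect_imp closed_Collect_eq
        closed_Collect_le continuous_intros cont open_Collect_const)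
  ultimately have compact: "compact (Y \<inter> Lin)"
    by blast
  have "Y \<inter> Lin \<inter> (\<Inter>p\<in>P. I p) \<noteq> {}"
  proof (rule compact_imp_fip_image[OF compact])
    show "closed (I p)" if "p \<in> P" for p
      unfolding I_def case_prod_unfold by (intro closed_Collect_le continuous_intros cont)
  next
    fix Q assume Q: "finite Q" "Q \<subseteq> P"
    \<comment> \<open>A translate changes the average of \<open>f\<close> by at most
      \<open>2 * B f * \<epsilon>\<close>, which has to stay below each tolerance in
      \<open>Q\<close>. The summand 1 keeps the denominator positive if \<open>B f = 0\<close>, and
      inserting 1 covers empty \<open>Q\<close>.\<close>
    define \<epsilon> where "\<epsilon> = Min (insert 1 ((\<lambda>(g, f, \<epsilon>). \<epsilon> / (2 * B f + 1)) ` Q))"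
    have "0 < \<epsilon>"
      using Q B(1) by (auto simp: \<epsilon>_def P_def add_nonneg_pos intro!: divide_pos_pos)
    moreover have "finite (fst ` Q)" "fst ` Q \<subseteq> carrier G"
      using Q by (auto simp: P_def)
    ultimately obtain E where E: "finite E" "E \<noteq> {}" "E \<subseteq> carrier G"
      and E': "\<And>g. g \<in> fst ` Q \<Longrightarrow> real (card ((\<lambda>x. g \<otimes> x) ` E - E)) \<le> \<epsilon> * real (card E)"
      using folner by metis
    have pos: "0 < real (card E)" using E by (simp add: card_gt_0_iff)
    \<comment> \<open>The default value 0 at unbounded functions keeps \<open>m\<close> inside
      \<open>Y\<close>, where nothing but \<open>0 \<le> B f\<close> is known for them.\<close>
    define m where "m = (\<lambda>f. if ?bdd f then sum f E / real (card E) else 0)"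
    have "m \<in> Y"
    proof -
      have "\<bar>m f\<bar> \<le> B f" for f
      proof (cases "?bdd f")
        case True
        have "\<bar>sum f E\<bar> \<le> (\<Sum>x\<in>E. \<bar>f x\<bar>)" by (rule sum_abs)
        also have "\<dots> \<le> (\<Sum>x\<in>E. B f)" using B(2)[OF True] E by (intro sum_mono) blast
        finally have "\<bar>sum f E\<bar> \<le> (\<Sum>x\<in>E. B f)" .
        then show ?thesis using True pos by (simp add: m_def divide_le_eq mult.commute)
      qed (simp add: m_def B(1))
      then show ?thesis by (simp add: Y_def abs_le_iff minus_le_iff)
    qed
    moreover have "m \<in> Lin"
    proof -
      have "m (\<lambda>x. f x + h x) = m f + m h" if "?bdd f" "?bdd h" for f h
        using that by (simp add: m_def bdd_add sum.distrib add_divide_distrib)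
      moreover have "m (\<lambda>x. c * f x) = c * m f" if "?bdd f" for c f
        using that by (simp add: m_def bdd_scale flip: sum_distrib_left)
      moreover have "0 \<le> m f" if "\<forall>x\<in>carrier G. 0 \<le> f x" for f
        using that E(3) by (simp add: m_def sum_nonneg subset_iff)
      moreover have "m (\<lambda>x. 1) = 1"
        using pos by (simp add: m_def image_constant_conv)
      ultimately show ?thesis by (simp add: Lin_def)
    qed
    moreover have "m \<in> I p" if "p \<in> Q" for p
    proof -
      obtain g f \<delta> where p: "p = (g, f, \<delta>)" by (cases p)
      have g: "g \<in> carrier G" and f: "?bdd f" and "0 < \<delta>"
        using Q that p by (auto simp: P_def)
      have "\<epsilon> \<le> \<delta> / (2 * B f + 1)"
        unfolding \<epsilon>_def using Q(1) that p by (intro Min_le) (auto intro!: image_eqI)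
      then have *: "\<epsilon> * (2 * B f + 1) \<le> \<delta>"
        using B(1)[of f] by (simp add: pos_le_divide_eq)
      have inj: "inj_on (\<lambda>x. g \<otimes> x) E"
        by (rule inj_on_subset[OF inj_on_cmult[OF g] E(3)])
      have "\<bar>(\<Sum>x\<in>E. f (g \<otimes> x)) - sum f E\<bar> \<le> 2 * B f * real (card ((\<lambda>x. g \<otimes> x) ` E - E))"
        using g E(3) B(2)[OF f] by (intro sum_image_diff_bound[OF E(1) inj]) auto
      also have "\<dots> \<le> 2 * B f * (\<epsilon> * real (card E))"
        using E'[of g] that p B(1)[of f] by (intro mult_left_mono) force+
      also have "\<dots> = (\<epsilon> * (2 * B f)) * real (card E)" by simp
      also have "\<dots> \<le> \<delta> * real (card E)"
      proof (rule mult_right_mono)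
        show "\<epsilon> * (2 * B f) \<le> \<delta>" using * \<open>0 < \<epsilon>\<close> unfolding distrib_left by linarith
      qed simp
      finally have "\<bar>(\<Sum>x\<in>E. f (g \<otimes> x)) - sum f E\<bar> \<le> \<delta> * real (card E)" .
      then have "\<bar>(\<Sum>x\<in>E. f (g \<otimes> x)) - sum f E\<bar> / real (card E) \<le> \<delta>"
        using pos by (simp add: divide_le_eq)
      then show ?thesis
        using f g pos by (simp add: p I_def m_def bdd_shift diff_divide_distrib[symmetric] abs_divide)
    qed
    ultimately show "Y \<inter> Lin \<inter> (\<Inter>p\<in>Q. I p) \<noteq> {}" by blast
  qed
  then obtain m where m: "m \<in> Lin" "\<And>p. p \<in> P \<Longrightarrow> m \<in> I p" by auto
  have "m (\<lambda>x. f (g \<otimes> x)) = m f" if "g \<in> carrier G" "?bdd f" for g f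
  proof -
    have "\<bar>m (\<lambda>x. f (g \<otimes> x)) - m f\<bar> \<le> 0 + \<epsilon>" if "0 < \<epsilon>" for \<epsilon>
      using m(2)[of "(g, f, \<epsilon>)"] that \<open>g \<in> _\<close> \<open>?bdd f\<close> by (simp add: P_def I_def)
    then have "\<bar>m (\<lambda>x. f (g \<otimes> x)) - m f\<bar> \<le> 0" by (rule field_le_epsilon)
    then show ?thesis by simp
  qed
  then have "left_invariant_mean G m"
    using m(1) by (simp add: left_invariant_mean_def Lin_def)
  then show ?thesis
    using is_group by (auto simp: amenable_group_def)
qed

section \<open>Polynomial growth for generators permuted by conjugation\<close>

text \<open>A sorted list is determined by the multiplicities of its \<open>m\<close> letters, and
  each multiplicity is one of the \<open>n + 1\<close> numbers up to \<open>n\<close>.\<close>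

lemma card_sorted_lists_le:
  "card {xs. sorted xs \<and> set xs \<subseteq> {..<m::nat} \<and> length xs = n} \<le> (n + 1) ^ m"
proof -
  let ?W = "{xs. sorted xs \<and> set xs \<subseteq> {..<m} \<and> length xs = n}"
  let ?c = "\<lambda>xs. \<lambda>i\<in>{..<m}. count_list xs i"
  have "inj_on ?c ?W"
  proof
    fix xs ys assume xs: "xs \<in> ?W" and ys: "ys \<in> ?W" and eq: "?c xs = ?c ys"
    have "count_list xs i = count_list ys i" for i
    proof (cases "i < m")
      case True
      then show ?thesis using fun_cong[OF eq, of i] by simp
    next
      case False
      then have "i \<notin> set xs" "i \<notin> set ys" using xs ys by auto
      then show ?thesis by (simp add: count_notin)
    qed
    then have "mset xs = mset ys" by (simp add: multiset_eq_iff count_mset)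
    then show "xs = ys" using xs ys by (metis (mono_tags, lifting) mem_Collect_eq properties_for_sort)
  qed
  moreover have "?c ` ?W \<subseteq> {..<m} \<rightarrow>\<^sub>E {..n}"
    by (auto simp: count_le_length split: if_splits)
  ultimately have "card ?W \<le> card ({..<m} \<rightarrow>\<^sub>E {..n})"
    by (intro card_inj_on_le) (auto intro: finite_PiE)
  then show ?thesis by (simp add: card_PiE)
qed

context group
begin

definition word :: "(nat \<Rightarrow> 'a) \<Rightarrow> nat list \<Rightarrow> 'a" where
  "word e xs = foldr (\<lambda>i. (\<otimes>) (e i)) xs \<one>"

lemma word_simps [simp]: "word e [] = \<one>" "word e (i # xs) = e i \<otimes> word e xs"
  by (simp_all add: word_def)

lemma word_closed: "e ` set xs \<subseteq> carrier G \<Longrightarrow> word e xs \<in> carrier G"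
  by (induction xs) auto

lemma word_append:
  "e ` set xs \<subseteq> carrier G \<Longrightarrow> e ` set ys \<subseteq> carrier G \<Longrightarrow> word e (xs @ ys) = word e xs \<otimes> word e ys"
  by (induction xs) (auto simp: word_closed m_assoc)

text \<open>Words have length exactly \<open>n\<close>. This is a ball in the usual sense once
  \<open>\<one>\<close> is among the letters, since shorter words can then be padded.\<close>

definition word_ball :: "(nat \<Rightarrow> 'a) \<Rightarrow> nat \<Rightarrow> nat \<Rightarrow> 'a set" where
  "word_ball e m n = word e ` {xs. set xs \<subseteq> {..<m} \<and> length xs = n}"

text \<open>If the generators are permuted by conjugation, then \<open>b a = a (a\<inverse> b a)\<close> moves the smaller
  of two adjacent letters to the left, so the lexicographically least word is sorted.\<close>

lemma word_ball_eq_sorted: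
  assumes e: "e ` {..<m} \<subseteq> carrier G"
    and conj: "\<And>i j. i < m \<Longrightarrow> j < m \<Longrightarrow> inv (e i) \<otimes> e j \<otimes> e i \<in> e ` {..<m}"
  shows "word_ball e m n = word e ` {xs. sorted xs \<and> set xs \<subseteq> {..<m} \<and> length xs = n}"
proof
  show "word_ball e m n \<subseteq> word e ` {xs. sorted xs \<and> set xs \<subseteq> {..<m} \<and> length xs = n}"
  proof
    fix w assume "w \<in> word_ball e m n"
    define Q where "Q = {xs. set xs \<subseteq> {..<m} \<and> length xs = n \<and> word e xs = w}"
    have "Q \<noteq> {}" using \<open>w \<in> word_ball e m n\<close> by (auto simp: word_ball_def Q_def)
    then obtain xs where xs: "xs \<in> Q" and least: "\<And>ys. (ys, xs) \<in> lex less_than \<Longrightarrow> ys \<notin> Q"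
      using wf_lex[OF wf_less_than] by (metis ex_in_conv wf_eq_minimal)
    have "sorted xs"
    proof (rule ccontr)
      assume "\<not> sorted xs"
      then obtain k where k: "Suc k < length xs" "xs ! Suc k < xs ! k"
        by (auto simp: sorted_iff_nth_Suc not_le)
      define a b us vs where "a = xs ! Suc k" and "b = xs ! k" and "us = take k xs"
        and "vs = drop (Suc (Suc k)) xs"
      have split: "xs = us @ b # a # vs"
        using k by (simp add: a_def b_def us_def vs_def Cons_nth_drop_Suc id_take_nth_drop)
      have sub: "set us \<subseteq> {..<m}" "set vs \<subseteq> {..<m}" "a < m" "b < m"
        using xs by (auto simp: split Q_def)
      then obtain c where c: "c < m" "inv (e a) \<otimes> e b \<otimes> e a = e c"
        using conj[of a b] by auto
      have car: "e ` set us \<subseteq> carrier G" "e ` set vs \<subseteq> carrier G" "e a \<in> carrier G" "e b \<in> carrier G"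
        "e c \<in> carrier G"
        using sub c(1) e by auto
      have "e a \<otimes> e c = e b \<otimes> e a"
        using car by (simp add: c(2)[symmetric] m_assoc[symmetric])
      then have "e a \<otimes> (e c \<otimes> word e vs) = e b \<otimes> (e a \<otimes> word e vs)"
        using car by (simp add: m_assoc[symmetric] word_closed)
      then have "word e (us @ a # c # vs) = word e xs"
        using car by (simp add: split word_append)
      then have "us @ a # c # vs \<in> Q"
        using xs sub c(1) by (auto simp: Q_def split)
      moreover have "(us @ a # c # vs, xs) \<in> lex less_than"
        unfolding split by (rule lex_append_leftI) (use k in \<open>simp add: a_def b_def\<close>)
      ultimately show False using least by blast
    qed
    then show "w \<in> word e ` {xs. sorted xs \<and> set xs \<subseteq> {..<m} \<and> length xs = n}"
      using xs by (auto simp: Q_def)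
  qed
qed (auto simp: word_ball_def)

lemma finite_word_ball: "finite (word_ball e m n)"
  using finite_lists_length_eq[of "{..<m}" n] by (simp add: word_ball_def)

lemma card_word_ball_le:
  assumes "e ` {..<m} \<subseteq> carrier G"
    and "\<And>i j. i < m \<Longrightarrow> j < m \<Longrightarrow> inv (e i) \<otimes> e j \<otimes> e i \<in> e ` {..<m}"
  shows "card (word_ball e m n) \<le> (n + 1) ^ m"
proof -
  let ?W = "{xs. sorted xs \<and> set xs \<subseteq> {..<m} \<and> length xs = n}"
  have "finite ?W"
    by (rule finite_subset[OF _ finite_lists_length_eq[of "{..<m}" n]]) auto
  then have "card (word e ` ?W) \<le> card ?W" by (rule card_image_le)
  then show ?thesis
    using card_sorted_lists_le[of m n] by (simp add: word_ball_eq_sorted[OF assms])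
qed

end

text \<open>If every ratio of consecutive terms exceeded \<open>1 + \<epsilon>\<close>, the sequence
  would grow exponentially and overtake the polynomial bound.\<close>

lemma slow_growth_ratio:
  fixes a :: "nat \<Rightarrow> nat"
  assumes "\<And>n. a n \<le> (n + 1) ^ m" "a 0 > 0" "0 < \<epsilon>"
  shows "\<exists>n. real (a (Suc n)) \<le> (1 + \<epsilon>) * real (a n)"
proof (rule ccontr)
  assume "\<not> ?thesis"
  then have less: "(1 + \<epsilon>) * real (a n) \<le> real (a (Suc n))" for n by (simp add: not_le less_imp_le)
  have "(1 + \<epsilon>) ^ n \<le> real (a n)" for n
  proof (induction n)
    case (Suc n)
    have "(1 + \<epsilon>) * (1 + \<epsilon>) ^ n \<le> (1 + \<epsilon>) * real (a n)"
      using Suc assms(3) by (intro mult_left_mono) auto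
    then show ?case using less[of n] by simp
  qed (use assms(2) in simp)
  then have le: "(1 + \<epsilon>) ^ n \<le> real (n + 1) ^ m" for n
    using assms(1)[of n] by (metis (no_types, lifting) of_nat_le_iff of_nat_power order_trans)
  have "((\<lambda>n. real (n + 1) ^ m / (1 + \<epsilon>) ^ n) \<longlongrightarrow> 0) at_top"
    using assms(3) by real_asymp
  then have "\<forall>\<^sub>F n in sequentially. real (n + 1) ^ m / (1 + \<epsilon>) ^ n < 1"
    by (rule order_tendstoD) simp
  then obtain n where "real (n + 1) ^ m / (1 + \<epsilon>) ^ n < 1"
    by (auto simp: eventually_sequentially)
  then show False using le[of n] assms(3) by (simp add: divide_less_eq)
qed

theorem (in group) amenable_group_if_finite_conjugacy_classes:
  assumes fc: "\<And>a. a \<in> carrier G \<Longrightarrow> finite ((\<lambda>x. inv x \<otimes> a \<otimes> x) ` carrier G)"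
  shows "amenable_group G"
proof (rule amenable_group_if_Folner)
  fix F and \<epsilon> :: real assume F: "finite F" "F \<subseteq> carrier G" and "0 < \<epsilon>"
  \<comment> \<open>A union of full conjugacy classes is stable under conjugation, and it is finite
    by hypothesis. The element \<open>\<one>\<close> is included to make the word balls increase
    with their length.\<close>
  define S where "S = (\<Union>a\<in>insert \<one> F. (\<lambda>x. inv x \<otimes> a \<otimes> x) ` carrier G)"
  have S: "finite S" "S \<subseteq> carrier G"
    unfolding S_def using F by (intro finite_UN_I finite_insert[THEN iffD2] fc; blast) (use F in auto)
  have mem: "a \<in> S" if "a \<in> insert \<one> F" for a
  proof -
    have "a = inv \<one> \<otimes> a \<otimes> \<one>" using that F by auto
    then show ?thesis unfolding S_def using that by blast
  qed
  have conj: "inv s \<otimes> t \<otimes> s \<in> S" if "s \<in> S" "t \<in> S" for s t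
  proof -
    obtain a x where a: "a \<in> insert \<one> F" "x \<in> carrier G" "t = inv x \<otimes> a \<otimes> x"
      using \<open>t \<in> S\<close> unfolding S_def by blast
    have "s \<in> carrier G" "a \<in> carrier G" using that S a F by auto
    then have "inv s \<otimes> t \<otimes> s = inv (x \<otimes> s) \<otimes> a \<otimes> (x \<otimes> s)"
      using a by (simp add: inv_mult_group m_assoc)
    then show ?thesis unfolding S_def using a \<open>s \<in> carrier G\<close> by blast
  qed
  obtain m and e :: "nat \<Rightarrow> 'a" where e: "e ` {..<m} = S"
    using finite_imp_nat_seg_image_inj_on[OF S(1)] by (metis lessThan_def)
  have ne: "word_ball e m n \<noteq> {}" for n
  proof (cases "m = 0")
    case True
    then show ?thesis using e mem[of \<one>] by auto
  next
    case False
    then have "word e (replicate n 0) \<in> word_ball e m n" by (auto simp: word_ball_def)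
    then show ?thesis by blast
  qed
  have "\<exists>n. real (card (word_ball e m (Suc n))) \<le> (1 + \<epsilon>) * real (card (word_ball e m n))"
  proof (rule slow_growth_ratio)
    show "card (word_ball e m n) \<le> (n + 1) ^ m" for n
      by (rule card_word_ball_le) (use e S conj in auto)
    show "0 < card (word_ball e m 0)" using ne finite_word_ball by (simp add: card_gt_0_iff)
  qed (rule \<open>0 < \<epsilon>\<close>)
  then obtain n where n: "real (card (word_ball e m (Suc n))) \<le> (1 + \<epsilon>) * real (card (word_ball e m n))" ..
  have step: "s \<otimes> x \<in> word_ball e m (Suc n)" if sx: "s \<in> S" "x \<in> word_ball e m n" for s x n
  proof -
    obtain i xs where "i < m" "s = e i" "set xs \<subseteq> {..<m}" "length xs = n" "x = word e xs"
      using sx unfolding e[symmetric] word_ball_def by auto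
    then have "s \<otimes> x = word e (i # xs)" "set (i # xs) \<subseteq> {..<m}" "length (i # xs) = Suc n" by auto
    then show ?thesis unfolding word_ball_def by blast
  qed
  have carr: "word_ball e m n \<subseteq> carrier G" for n
    using S e by (force simp: word_ball_def intro!: word_closed)
  have sub: "word_ball e m n \<subseteq> word_ball e m (Suc n)"
  proof
    fix x assume x: "x \<in> word_ball e m n"
    then show "x \<in> word_ball e m (Suc n)"
      using step[OF mem[OF insertI1] x] carr[of n] by (simp add: subset_iff)
  qed
  \<comment> \<open>A translate by \<open>g \<in> F\<close> stays in the next ball, so what leaves
    the ball of length \<open>n\<close> is counted by the increment, which is at most
    \<open>\<epsilon>\<close> times its size by the choice of \<open>n\<close>.\<close>
  have "real (card ((\<lambda>x. g \<otimes> x) ` word_ball e m n - word_ball e m n)) \<le> \<epsilon> * real (card (word_ball e m n))"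
    if "g \<in> F" for g
  proof -
    have "card ((\<lambda>x. g \<otimes> x) ` word_ball e m n - word_ball e m n) \<le> card (word_ball e m (Suc n) - word_ball e m n)"
      using that step[OF mem] by (intro card_mono finite_Diff finite_word_ball) auto
    also have "\<dots> = card (word_ball e m (Suc n)) - card (word_ball e m n)"
      by (rule card_Diff_subset[OF finite_word_ball sub])
    finally show ?thesis
      using n card_mono[OF finite_word_ball sub] by (simp add: algebra_simps)
  qed
  then show "\<exists>E. finite E \<and> E \<noteq> {} \<and> E \<subseteq> carrier G \<and>
      (\<forall>g\<in>F. real (card ((\<lambda>x. g \<otimes> x) ` E - E)) \<le> \<epsilon> * real (card E))"
    by (intro exI[of _ "word_ball e m n"] conjI ballI finite_word_ball ne carr)
qed

subsection \<open>Finite index and the profinite closure\<close>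

context group
begin

lemma inv_mult_cancel_left:
  assumes "x \<in> carrier G" "y \<in> carrier G"
  shows "inv x \<otimes> (x \<otimes> y) = y" "x \<otimes> (inv x \<otimes> y) = y"
  using assms by (simp_all add: m_assoc[symmetric])

lemmas group_word_simps = m_assoc inv_mult_group inv_mult_cancel_left

lemma set_mult_mono_left: "A \<subseteq> B \<Longrightarrow> A <#> C \<subseteq> B <#> C"
  unfolding set_mult_def by blast

text \<open>Restricting the carrier leaves the multiplication unchanged, so cosets taken in
  \<open>H\<close> are cosets in \<open>G\<close>. All later arguments can thus remain in
  \<open>G\<close>.\<close>

lemma finite_index_subgroup_iff:
  assumes "subgroup H G"
  shows "finite_index_subgroup G H K \<longleftrightarrow> subgroup K G \<and> K \<subseteq> H \<and> finite ((\<lambda>h. K #> h) ` H)"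
proof -
  have "rcosets\<^bsub>G\<lparr>carrier := H\<rparr>\<^esub> K = (\<lambda>h. K #> h) ` H"
    by (auto simp: RCOSETS_def r_coset_def)
  moreover have "subgroup K (G\<lparr>carrier := H\<rparr>) \<longleftrightarrow> subgroup K G \<and> K \<subseteq> H"
    using incl_subgroup[OF assms] subgroup_incl[OF _ assms] subgroup.subset[of K "G\<lparr>carrier := H\<rparr>"] by auto
  ultimately show ?thesis by (simp add: finite_index_subgroup_def)
qed

text \<open>Every coset of \<open>K\<close> in \<open>H\<close> is the coset of some element of
  \<open>T\<close>. The covering set may lie outside \<open>H\<close>.\<close>

lemma finite_index_subgroupI:
  assumes "subgroup H G" "subgroup K G" "K \<subseteq> H" "finite T" "T \<subseteq> carrier G" "H \<subseteq> K <#> T"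
  shows "finite_index_subgroup G H K"
proof -
  have "K #> h \<in> (\<lambda>t. K #> t) ` T" if "h \<in> H" for h
  proof -
    obtain k t where "k \<in> K" "t \<in> T" "h = k \<otimes> t"
      using \<open>h \<in> H\<close> assms(6) by (auto simp: set_mult_def)
    then have "K #> t = K #> h"
      using assms by (intro repr_independence) (auto simp: r_coset_def)
    then show ?thesis using \<open>t \<in> T\<close> by auto
  qed
  then have "(\<lambda>h. K #> h) ` H \<subseteq> (\<lambda>t. K #> t) ` T" by blast
  then show ?thesis
    using assms by (meson finite_imageI finite_subset finite_index_subgroup_iff)
qed

lemma finite_index_subgroupD:
  assumes "subgroup H G" "finite_index_subgroup G H K"
  shows "subgroup K G" "K \<subseteq> H"
  using assms by (simp_all add: finite_index_subgroup_iff)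

lemma finite_index_subgroup_transversal:
  assumes "subgroup H G" "finite_index_subgroup G H K"
  obtains T where "finite T" "T \<subseteq> H" "H \<subseteq> K <#> T"
proof -
  have K: "subgroup K G" "K \<subseteq> H" "finite ((\<lambda>h. K #> h) ` H)"
    using assms by (simp_all add: finite_index_subgroup_iff)
  obtain T where T: "finite T" "T \<subseteq> H" "(\<lambda>h. K #> h) ` H = (\<lambda>h. K #> h) ` T"
    using finite_subset_image[OF K(3) subset_refl] by blast
  have "h \<in> K <#> T" if h: "h \<in> H" for h
  proof -
    obtain t where "t \<in> T" "K #> h = K #> t" using imageI[OF h, of "\<lambda>h. K #> h"] T(3) by auto
    then have "h \<in> K #> t"
      using rcos_self[of h K] h K(1) subgroup.mem_carrier[OF assms(1)] by blast
    then show ?thesis using \<open>t \<in> T\<close> by (auto simp: r_coset_def set_mult_def)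
  qed
  then have "H \<subseteq> K <#> T" by (rule subsetI)
  then show ?thesis by (rule that[OF T(1,2)])
qed

lemma finite_index_subgroup_mono:
  assumes "subgroup H G" "finite_index_subgroup G H K" "subgroup K' G" "K \<subseteq> K'" "K' \<subseteq> H"
  shows "finite_index_subgroup G H K'"
proof -
  obtain T where T: "finite T" "T \<subseteq> H" "H \<subseteq> K <#> T"
    by (rule finite_index_subgroup_transversal[OF assms(1,2)])
  have "H \<subseteq> K' <#> T" using T(3) set_mult_mono_left[OF assms(4)] by (rule subset_trans)
  then show ?thesis
    using assms(1,3,5) T(1) subset_trans[OF T(2) subgroup.subset[OF assms(1)]]
    by (intro finite_index_subgroupI)
qed

text \<open>A coset of \<open>K \<inter> K'\<close> is the intersection of a coset of
  \<open>K\<close> with one of \<open>K'\<close>, and only finitely many such pairs exist.\<close>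

lemma finite_index_subgroup_Int:
  assumes "subgroup H G" "subgroup H' G"
    and "finite_index_subgroup G H K" "finite_index_subgroup G H' K'"
  shows "finite_index_subgroup G (H \<inter> H') (K \<inter> K')"
proof -
  have K: "subgroup K G" "K \<subseteq> H" "finite ((\<lambda>h. K #> h) ` H)"
    and K': "subgroup K' G" "K' \<subseteq> H'" "finite ((\<lambda>h. K' #> h) ` H')"
    using assms by (simp_all add: finite_index_subgroup_iff)
  have "(K \<inter> K') #> h = (K #> h) \<inter> (K' #> h)" if "h \<in> carrier G" for h
    using that subgroup.mem_carrier[OF K(1)] subgroup.mem_carrier[OF K'(1)]
    by (auto simp: r_coset_def)
  then have "(\<lambda>h. (K \<inter> K') #> h) ` (H \<inter> H') = (\<lambda>h. (K #> h) \<inter> (K' #> h)) ` (H \<inter> H')"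
    using subgroup.mem_carrier[OF assms(1)] by (intro image_cong) auto
  also have "\<dots> \<subseteq> (\<lambda>(A, B). A \<inter> B) ` ((\<lambda>h. K #> h) ` H \<times> (\<lambda>h. K' #> h) ` H')"
    by auto
  finally have "(\<lambda>h. (K \<inter> K') #> h) ` (H \<inter> H') \<subseteq>
      (\<lambda>(A, B). A \<inter> B) ` ((\<lambda>h. K #> h) ` H \<times> (\<lambda>h. K' #> h) ` H')" .
  then have "finite ((\<lambda>h. (K \<inter> K') #> h) ` (H \<inter> H'))"
    by (rule finite_subset) (intro finite_imageI finite_cartesian_product K(3) K'(3))
  moreover have "subgroup (H \<inter> H') G" "subgroup (K \<inter> K') G"
    using K(1) K'(1) assms by (simp_all add: subgroups_Inter_pair)
  ultimately show ?thesis
    using K(2) K'(2) finite_index_subgroup_iff[of "H \<inter> H'"] by blast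
qed

lemma finite_index_subgroup_refl: "subgroup H G \<Longrightarrow> finite_index_subgroup G H H"
  by (rule finite_index_subgroupI[of _ _ "{\<one>}"]) (auto simp: set_mult_def subgroup.mem_carrier)

lemma finite_index_subgroup_Int_left:
  assumes "subgroup H G" "subgroup A G" "finite_index_subgroup G H K"
  shows "finite_index_subgroup G (A \<inter> H) (A \<inter> K)"
  using assms by (intro finite_index_subgroup_Int finite_index_subgroup_refl)

section \<open>The profinite topology and closures of subgroups\<close>

text \<open>These are the basic neighbourhoods of \<open>\<one>\<close> in the profinite
  topology.\<close>

definition cofinite_normal :: "'a set \<Rightarrow> bool" where
  "cofinite_normal L \<longleftrightarrow> L \<lhd> G \<and> finite_index_subgroup G (carrier G) L"

lemma cofinite_normalD: "cofinite_normal L \<Longrightarrow> L \<lhd> G" "cofinite_normal L \<Longrightarrow> subgroup L G"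
  by (simp_all add: cofinite_normal_def normal_imp_subgroup)

lemma cofinite_normal_carrier: "cofinite_normal (carrier G)"
  by (simp add: cofinite_normal_def finite_index_subgroup_refl subgroup_self normal_inv_iff)

lemma cofinite_normal_Int:
  assumes "cofinite_normal L" "cofinite_normal L'"
  shows "cofinite_normal (L \<inter> L')"
  using assms finite_index_subgroup_Int[of "carrier G" "carrier G" L L']
  by (simp add: cofinite_normal_def normal_subgroup_intersect subgroup_self)

text \<open>Intersecting the finitely many witnesses works because \<open>Q i\<close> passes to
  smaller subgroups. This is how one neighbourhood is chosen for a whole transversal or generating
  set.\<close>

lemma cofinite_normal_common:
  assumes "finite I" "\<And>i. i \<in> I \<Longrightarrow> \<exists>L. cofinite_normal L \<and> Q i L"
    and "\<And>i L L'. i \<in> I \<Longrightarrow> Q i L \<Longrightarrow> L' \<subseteq> L \<Longrightarrow> Q i L'"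
  shows "\<exists>L. cofinite_normal L \<and> (\<forall>i\<in>I. Q i L)"
  using assms
proof (induction I rule: finite_induct)
  case empty
  then show ?case using cofinite_normal_carrier by blast
next
  case (insert i I)
  then obtain L where L: "cofinite_normal L" "\<forall>i\<in>I. Q i L" by blast
  obtain M where M: "cofinite_normal M" "Q i M" using insert.prems(1) by blast
  have "cofinite_normal (L \<inter> M)" using L M by (simp add: cofinite_normal_Int)
  moreover have "Q j (L \<inter> M)" if "j \<in> insert i I" for j
  proof (cases "j = i")
    case True
    then show ?thesis using insert.prems(2)[of i M "L \<inter> M"] M by simp
  next
    case False
    then show ?thesis using insert.prems(2)[of j L "L \<inter> M"] L that by simp
  qed
  ultimately show ?case by blast
qed

text \<open>Closure in the profinite topology: \<open>x \<in> L <#> A\<close> says that the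
  neighbourhood \<open>L #> x\<close> of \<open>x\<close> meets \<open>A\<close>.\<close>

definition profinite_closure :: "'a set \<Rightarrow> 'a set" where
  "profinite_closure A = {x \<in> carrier G. \<forall>L. cofinite_normal L \<longrightarrow> x \<in> L <#> A}"

lemma profinite_closure_mono: "A \<subseteq> B \<Longrightarrow> profinite_closure A \<subseteq> profinite_closure B"
  by (fastforce simp: profinite_closure_def set_mult_def)

lemma profinite_closure_subset: "subgroup A G \<Longrightarrow> A \<subseteq> profinite_closure A"
proof
  fix x assume A: "subgroup A G" and x: "x \<in> A"
  have "x \<in> L <#> A" if "cofinite_normal L" for L
  proof -
    have "\<one> \<in> L" using that by (meson cofinite_normalD subgroup.one_closed)
    then have "\<one> \<otimes> x \<in> L <#> A" using x unfolding set_mult_def by blast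
    then show ?thesis using x A by (simp add: subgroup.mem_carrier)
  qed
  then show "x \<in> profinite_closure A"
    using x A by (simp add: profinite_closure_def subgroup.mem_carrier)
qed

text \<open>Each \<open>L <#> A\<close> is a subgroup because \<open>L\<close> is normal, and the
  closure is the intersection of these.\<close>

lemma subgroup_profinite_closure:
  assumes "subgroup A G"
  shows "subgroup (profinite_closure A) G"
proof -
  have sub: "subgroup (L <#> A) G" if "cofinite_normal L" for L
    using mult_norm_subgroup[OF cofinite_normalD(1)[OF that] assms] .
  have "profinite_closure A = (\<Inter>L\<in>Collect cofinite_normal. L <#> A)"
    using cofinite_normal_carrier subgroup.subset[OF sub] by (auto simp: profinite_closure_def)
  also have "subgroup \<dots> G"
    using cofinite_normal_carrier sub by (intro subgroups_Inter) auto
  finally show ?thesis .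
qed

text \<open>The set \<open>A <#> T\<close> is a finite union of translates of \<open>A\<close>. A
  point outside the closure of every translate is separated from all of them by a single
  \<open>L\<close>.\<close>

lemma profinite_closure_finite_union:
  assumes A: "subgroup A G" and T: "finite T" "T \<subseteq> carrier G"
  shows "profinite_closure (A <#> T) \<subseteq> profinite_closure A <#> T"
proof
  fix x assume x: "x \<in> profinite_closure (A <#> T)"
  then have xc: "x \<in> carrier G" by (simp add: profinite_closure_def)
  have "\<exists>t\<in>T. x \<otimes> inv t \<in> profinite_closure A"
  proof (rule ccontr)
    assume "\<not> ?thesis"
    then have ex: "\<exists>L. cofinite_normal L \<and> x \<otimes> inv t \<notin> L <#> A" if "t \<in> T" for t
      using that subsetD[OF T(2) that] xc by (auto simp: profinite_closure_def)
    have "\<exists>L. cofinite_normal L \<and> (\<forall>t\<in>T. x \<otimes> inv t \<notin> L <#> A)"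
      using T(1) ex by (rule cofinite_normal_common) (use set_mult_mono_left in blast)+
    then obtain L where L: "cofinite_normal L" "\<forall>t\<in>T. x \<otimes> inv t \<notin> L <#> A"
      by blast
    obtain l a t where "l \<in> L" "a \<in> A" "t \<in> T" "x = l \<otimes> (a \<otimes> t)"
      using x L(1) by (auto simp: profinite_closure_def set_mult_def)
    moreover then have "x \<otimes> inv t = l \<otimes> a"
      using T subgroup.mem_carrier[OF A] subgroup.mem_carrier[OF cofinite_normalD(2)[OF L(1)]]
      by (simp add: m_assoc subset_iff)
    ultimately show False using L(2) by (auto simp: set_mult_def)
  qed
  then obtain t where t: "t \<in> T" "x \<otimes> inv t \<in> profinite_closure A" by blast
  then have "x = (x \<otimes> inv t) \<otimes> t" using xc T by (simp add: m_assoc subset_iff)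
  then show "x \<in> profinite_closure A <#> T" using t unfolding set_mult_def by blast
qed

text \<open>A finite transversal of \<open>K\<close> in \<open>H\<close> still covers after passing
  to closures, by the finite union property.\<close>

lemma finite_index_profinite_closure:
  assumes "subgroup H G" "finite_index_subgroup G H K"
  shows "finite_index_subgroup G (profinite_closure H) (profinite_closure K)"
proof -
  have K: "subgroup K G" "K \<subseteq> H" using finite_index_subgroupD[OF assms] by auto
  obtain T where T: "finite T" "T \<subseteq> H" "H \<subseteq> K <#> T"
    by (rule finite_index_subgroup_transversal[OF assms])
  have Tc: "T \<subseteq> carrier G" using T(2) subgroup.subset[OF assms(1)] by blast
  have "profinite_closure H \<subseteq> profinite_closure K <#> T"
    using profinite_closure_mono[OF T(3)] profinite_closure_finite_union[OF K(1) T(1) Tc] by blast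
  then show ?thesis
    using assms K T Tc
    by (intro finite_index_subgroupI subgroup_profinite_closure profinite_closure_mono) auto
qed

lemma conj_set_eq:
  assumes g: "g \<in> carrier G" and A: "A \<subseteq> carrier G"
  shows "g <# A #> inv g = {x \<in> carrier G. inv g \<otimes> x \<otimes> g \<in> A}"
proof -
  have "x \<in> g <# A #> inv g" if "x \<in> carrier G" "inv g \<otimes> x \<otimes> g \<in> A" for x
  proof -
    have "g \<otimes> (inv g \<otimes> x \<otimes> g) \<otimes> inv g = x"
      using g that(1) by (simp add: group_word_simps)
    then show ?thesis using that(2) unfolding l_coset_def r_coset_def by force
  qed
  moreover have "inv g \<otimes> (g \<otimes> a \<otimes> inv g) \<otimes> g = a" if "a \<in> A" for a
    using g subsetD[OF A that] by (simp add: group_word_simps)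
  ultimately show ?thesis using g A by (auto simp: l_coset_def r_coset_def)
qed

lemma conj_mult:
  "g \<in> carrier G \<Longrightarrow> x \<in> carrier G \<Longrightarrow> y \<in> carrier G \<Longrightarrow>
    inv g \<otimes> (x \<otimes> y) \<otimes> g = (inv g \<otimes> x \<otimes> g) \<otimes> (inv g \<otimes> y \<otimes> g)"
  by (simp add: group_word_simps)

lemma subgroup_conj_set:
  assumes g: "g \<in> carrier G" and A: "subgroup A G"
  shows "subgroup (g <# A #> inv g) G"
proof -
  have "inv g \<otimes> inv x \<otimes> g = inv (inv g \<otimes> x \<otimes> g)" if "x \<in> carrier G" for x
    using g that by (simp add: inv_mult_group m_assoc)
  then have "subgroup {x \<in> carrier G. inv g \<otimes> x \<otimes> g \<in> A} G"
    using g A conj_mult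
    by (intro subgroupI) (auto simp: subgroup.m_closed subgroup.m_inv_closed subgroup.one_closed)
  then show ?thesis using g subgroup.subset[OF A] by (simp add: conj_set_eq)
qed

text \<open>Conjugation maps each \<open>L\<close> to itself, hence is compatible with the
  topology.\<close>

lemma profinite_closure_conj:
  assumes g: "g \<in> carrier G" and A: "A \<subseteq> carrier G"
  shows "profinite_closure (g <# A #> inv g) \<subseteq> g <# profinite_closure A #> inv g"
proof
  fix x assume x: "x \<in> profinite_closure (g <# A #> inv g)"
  then have xc: "x \<in> carrier G" by (simp add: profinite_closure_def)
  have "inv g \<otimes> x \<otimes> g \<in> L <#> A" if L: "cofinite_normal L" for L
  proof -
    obtain l y where ly: "l \<in> L" "y \<in> g <# A #> inv g" "x = l \<otimes> y"
      using x L by (auto simp: profinite_closure_def set_mult_def)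
    have y: "y \<in> carrier G" "inv g \<otimes> y \<otimes> g \<in> A" using ly(2) g A by (simp_all add: conj_set_eq)
    have l: "l \<in> carrier G" using ly(1) cofinite_normalD(2)[OF L] by (simp add: subgroup.mem_carrier)
    have "inv g \<otimes> l \<otimes> g \<in> L"
      using normal.inv_op_closed1[OF cofinite_normalD(1)[OF L] g ly(1)] .
    moreover have "inv g \<otimes> x \<otimes> g = (inv g \<otimes> l \<otimes> g) \<otimes> (inv g \<otimes> y \<otimes> g)"
      using g l y(1) by (simp add: ly(3) conj_mult)
    ultimately show ?thesis using y(2) by (auto simp: set_mult_def)
  qed
  then have "inv g \<otimes> x \<otimes> g \<in> profinite_closure A"
    using g xc by (simp add: profinite_closure_def)
  moreover have "profinite_closure A \<subseteq> carrier G" by (auto simp: profinite_closure_def)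
  ultimately show "x \<in> g <# profinite_closure A #> inv g"
    using g xc by (simp add: conj_set_eq)
qed

section \<open>Closed commensurated subgroups\<close>

text \<open>The closure of \<open>H \<inter> gHg^-1\<close> has finite index in the closure
  \<open>J\<close> of \<open>H\<close>, and it is contained in
  \<open>J \<inter> gJg^-1\<close>.\<close>

lemma commensurated_profinite_closure:
  assumes "commensurated H G"
  shows "commensurated (profinite_closure H) G"
proof -
  have H: "subgroup H G" using assms by (simp add: commensurated_def)
  let ?J = "profinite_closure H"
  have J: "subgroup ?J G" using H by (rule subgroup_profinite_closure)
  have "finite_index_subgroup G ?J (?J \<inter> (g <# ?J #> inv g))" if g: "g \<in> carrier G" for g
  proof (rule finite_index_subgroup_mono[OF J])
    have "finite_index_subgroup G H (H \<inter> (g <# H #> inv g))"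
      using assms g by (simp add: commensurated_def)
    then show "finite_index_subgroup G ?J (profinite_closure (H \<inter> (g <# H #> inv g)))"
      by (rule finite_index_profinite_closure[OF H])
    show "subgroup (?J \<inter> (g <# ?J #> inv g)) G"
      using g J by (intro subgroups_Inter_pair subgroup_conj_set)
    show "profinite_closure (H \<inter> (g <# H #> inv g)) \<subseteq> ?J \<inter> (g <# ?J #> inv g)"
      using profinite_closure_conj[OF g subgroup.subset[OF H]]
        profinite_closure_mono[of "H \<inter> (g <# H #> inv g)" H]
        profinite_closure_mono[of "H \<inter> (g <# H #> inv g)" "g <# H #> inv g"] by blast
  qed simp
  then show ?thesis using J by (simp add: commensurated_def)
qed

text \<open>The last premise is membership in the closure of the closure, and the factor
  \<open>L\<close> is absorbed by \<open>L <#> L = L\<close>.\<close>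

lemma profinite_closure_idem:
  assumes "subgroup A G" "x \<in> carrier G" "\<And>L. cofinite_normal L \<Longrightarrow> x \<in> L <#> profinite_closure A"
  shows "x \<in> profinite_closure A"
proof -
  have "x \<in> L <#> A" if L: "cofinite_normal L" for L
  proof -
    obtain l j where l: "l \<in> L" "j \<in> profinite_closure A" "x = l \<otimes> j"
      using assms(3)[OF L] by (auto simp: set_mult_def)
    then obtain l' a where "l' \<in> L" "a \<in> A" "j = l' \<otimes> a"
      using L by (auto simp: profinite_closure_def set_mult_def)
    moreover then have "x = (l \<otimes> l') \<otimes> a" "l \<otimes> l' \<in> L"
      using l subgroup.mem_carrier[OF assms(1)] cofinite_normalD(2)[OF L]
      by (auto simp: m_assoc subgroup.mem_carrier subgroup.m_closed)
    ultimately show ?thesis unfolding set_mult_def by blast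
  qed
  then show ?thesis using assms(2) by (simp add: profinite_closure_def)
qed

text \<open>An element \<open>x \<in> J \<inter> L\<close> has the form \<open>y t\<close> with \<open>y \<in> J \<inter> s J s\<inverse>\<close> and \<open>t\<close> in a finite
  transversal, and then \<open>s\<inverse> t s \<in> J L\<close>; since \<open>J\<close> is closed, a small \<open>L\<close> forces \<open>s\<inverse> t s \<in> J\<close>, hence
  \<open>s\<inverse> x s \<in> J\<close>.\<close>

lemma closed_commensurated_conj:
  assumes J: "commensurated J G"
    and closed: "profinite_closure J \<subseteq> J"
    and s: "s \<in> carrier G"
  shows "\<exists>L. cofinite_normal L \<and> (\<forall>x\<in>J \<inter> L. inv s \<otimes> x \<otimes> s \<in> J)"
proof -
  have sJ: "subgroup J G" using J by (simp add: commensurated_def)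
  have "finite_index_subgroup G J (J \<inter> (s <# J #> inv s))"
    using J s by (simp add: commensurated_def)
  then obtain T where T: "finite T" "T \<subseteq> J" "J \<subseteq> (J \<inter> (s <# J #> inv s)) <#> T"
    by (rule finite_index_subgroup_transversal[OF sJ])
  \<comment> \<open>If the conjugate of \<open>t\<close> lies outside the closed set
    \<open>J\<close>, some \<open>L\<close> separates it from \<open>J\<close>; if it lies in
    \<open>J\<close>, any \<open>L\<close> serves.\<close>
  have "\<exists>L. cofinite_normal L \<and> (inv s \<otimes> t \<otimes> s \<notin> J \<longrightarrow> inv s \<otimes> t \<otimes> s \<notin> L <#> J)" if "t \<in> T" for t
  proof -
    have "inv s \<otimes> t \<otimes> s \<in> carrier G" using that T(2) s subgroup.mem_carrier[OF sJ] by auto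
    then show ?thesis using closed cofinite_normal_carrier by (auto simp: profinite_closure_def)
  qed
  then have "\<exists>L. cofinite_normal L \<and> (\<forall>t\<in>T. inv s \<otimes> t \<otimes> s \<notin> J \<longrightarrow> inv s \<otimes> t \<otimes> s \<notin> L <#> J)"
    using T(1) set_mult_mono_left by (intro cofinite_normal_common) blast+
  then obtain L where L: "cofinite_normal L"
    and LT: "\<And>t. t \<in> T \<Longrightarrow> inv s \<otimes> t \<otimes> s \<notin> J \<Longrightarrow> inv s \<otimes> t \<otimes> s \<notin> L <#> J"
    by blast
  have "inv s \<otimes> x \<otimes> s \<in> J" if x: "x \<in> J" "x \<in> L" for x
  proof -
    obtain y t where y: "y \<in> J \<inter> (s <# J #> inv s)" and t: "t \<in> T" and xyt: "x = y \<otimes> t"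
      using subsetD[OF T(3) x(1)] by (auto simp: set_mult_def)
    have c: "y \<in> carrier G" "t \<in> carrier G" "x \<in> carrier G"
      using y t x(1) T(2) subgroup.mem_carrier[OF sJ] by auto
    have yJ: "inv s \<otimes> y \<otimes> s \<in> J" using y s subgroup.subset[OF sJ] by (simp add: conj_set_eq)
    have eq: "inv s \<otimes> x \<otimes> s = (inv s \<otimes> y \<otimes> s) \<otimes> (inv s \<otimes> t \<otimes> s)"
      using s c by (simp add: xyt conj_mult)
    have "inv s \<otimes> x \<otimes> s \<in> L" using normal.inv_op_closed1[OF cofinite_normalD(1)[OF L] s x(2)] .
    moreover have "inv s \<otimes> t \<otimes> s = inv (inv s \<otimes> y \<otimes> s) \<otimes> (inv s \<otimes> x \<otimes> s)"
      using s c by (simp add: eq group_word_simps)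
    ultimately have "inv s \<otimes> t \<otimes> s \<in> J <#> L"
      using yJ subgroup.m_inv_closed[OF sJ] by (auto simp: set_mult_def)
    then have "inv s \<otimes> t \<otimes> s \<in> L <#> J"
      using commut_normal[OF sJ cofinite_normalD(1)[OF L]] by simp
    then have "inv s \<otimes> t \<otimes> s \<in> J" using LT t by blast
    then show ?thesis using yJ subgroup.m_closed[OF sJ] by (simp add: eq)
  qed
  then show ?thesis using L by blast
qed

text \<open>Elements conjugating \<open>M\<close> into itself are closed under products. Inverses of
  generators are listed separately because the inclusion \<open>s^-1 M s \<subseteq> M\<close> alone
  need not give the one for the inverse of \<open>s\<close>.\<close>

lemma normal_if_generators_conj:
  assumes M: "subgroup M G" and S: "S \<subseteq> carrier G" "generate G S = carrier G"
    and conj: "\<And>s x. s \<in> S \<union> m_inv G ` S \<Longrightarrow> x \<in> M \<Longrightarrow> inv s \<otimes> x \<otimes> s \<in> M"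
  shows "M \<lhd> G"
proof -
  have "\<forall>x\<in>M. g \<otimes> x \<otimes> inv g \<in> M" if "g \<in> generate G S" for g
    using that
  proof induction
    case one
    then show ?case using M by (simp add: subgroup.mem_carrier)
  next
    case (incl h)
    then show ?case using conj[of "inv h"] S(1) by auto
  next
    case (inv h)
    then show ?case using conj[of h] S(1) by auto
  next
    case (eng h1 h2)
    have c: "h1 \<in> carrier G" "h2 \<in> carrier G" using eng S(2) by auto
    show ?case
    proof
      fix x assume x: "x \<in> M"
      have "h1 \<otimes> h2 \<otimes> x \<otimes> inv (h1 \<otimes> h2) = h1 \<otimes> (h2 \<otimes> x \<otimes> inv h2) \<otimes> inv h1"
        using c subgroup.mem_carrier[OF M x] by (simp add: inv_mult_group m_assoc)
      then show "h1 \<otimes> h2 \<otimes> x \<otimes> inv (h1 \<otimes> h2) \<in> M" using eng x by simp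
    qed
  qed
  then show ?thesis using M S(2) by (simp add: normal_inv_iff)
qed

text \<open>Finite generation enters here: only finitely many neighbourhoods, one for each generator
  and each inverse, have to be intersected.\<close>

theorem closed_commensurated_virtually_normal:
  assumes fg: "finitely_generated_group G"
    and J: "commensurated J G"
    and closed: "profinite_closure J \<subseteq> J"
  shows "\<exists>L. cofinite_normal L \<and> J \<inter> L \<lhd> G"
proof -
  have sJ: "subgroup J G" using J by (simp add: commensurated_def)
  obtain S where S: "finite S" "S \<subseteq> carrier G" "generate G S = carrier G"
    using fg by (auto simp: finitely_generated_group_def)
  have "\<exists>L. cofinite_normal L \<and> (\<forall>s\<in>S \<union> m_inv G ` S. \<forall>x\<in>J \<inter> L. inv s \<otimes> x \<otimes> s \<in> J)"
    using S(1,2) by (intro cofinite_normal_common closed_commensurated_conj[OF J closed]) auto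
  then obtain L where L: "cofinite_normal L"
    and conj: "\<And>s x. s \<in> S \<union> m_inv G ` S \<Longrightarrow> x \<in> J \<inter> L \<Longrightarrow> inv s \<otimes> x \<otimes> s \<in> J"
    by blast
  have "J \<inter> L \<lhd> G"
  proof (rule normal_if_generators_conj[OF _ S(2,3)])
    show "subgroup (J \<inter> L) G" using sJ cofinite_normalD(2)[OF L] by (rule subgroups_Inter_pair)
    fix s x assume s: "s \<in> S \<union> m_inv G ` S" and x: "x \<in> J \<inter> L"
    have "inv s \<otimes> x \<otimes> s \<in> L"
      using normal.inv_op_closed1[OF cofinite_normalD(1)[OF L], of s x] s x S(2) by auto
    then show "inv s \<otimes> x \<otimes> s \<in> J \<inter> L" using conj[OF s x] by simp
  qed
  then show ?thesis using L by blast
qed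

section \<open>Centralizers and finite conjugacy classes\<close>

lemma subgroup_centralizer:
  assumes "A \<subseteq> carrier G"
  shows "subgroup (centralizer G A) G"
proof (rule subgroupI)
  show "centralizer G A \<noteq> {}" using assms by (auto simp: centralizer_def intro!: exI[of _ "\<one>"])
next
  fix x assume "x \<in> centralizer G A"
  then show "inv x \<in> centralizer G A"
    using assms by (auto simp: centralizer_def inv_solve_left inv_solve_right m_assoc)
next
  fix x y assume "x \<in> centralizer G A" "y \<in> centralizer G A"
  then show "x \<otimes> y \<in> centralizer G A"
    using assms by (auto simp: centralizer_def) (metis m_assoc subsetD)
qed (auto simp: centralizer_def)

lemma commutator_eq_one_iff:
  assumes "x \<in> carrier G" "y \<in> carrier G"
  shows "x \<otimes> y \<otimes> inv x \<otimes> inv y = \<one> \<longleftrightarrow> x \<otimes> y = y \<otimes> x"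
proof -
  have "x \<otimes> y \<otimes> inv x \<otimes> inv y = (x \<otimes> y) \<otimes> inv (y \<otimes> x)"
    using assms by (simp add: group_word_simps)
  then show ?thesis
    using assms inv_solve_right'[of \<one> "x \<otimes> y" "y \<otimes> x"] by simp
qed

text \<open>Write \<open>x = l c\<close> with \<open>l \<in> L\<close> and \<open>c\<close>
  commuting with \<open>a\<close>. Then the commutator of \<open>x\<close> and \<open>a\<close>
  equals that of \<open>l\<close> and \<open>a\<close>, so it lies in every \<open>L\<close> and is
  trivial by residual finiteness.\<close>

lemma profinite_closure_centralizer:
  assumes rf: "residually_finite_group G" and A: "A \<subseteq> carrier G"
  shows "profinite_closure (centralizer G A) \<subseteq> centralizer G A"
proof
  fix x assume x: "x \<in> profinite_closure (centralizer G A)"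
  then have xc: "x \<in> carrier G" by (simp add: profinite_closure_def)
  have "x \<otimes> a = a \<otimes> x" if a: "a \<in> A" for a
  proof -
    have ac: "a \<in> carrier G" using a A by auto
    have "x \<otimes> a \<otimes> inv x \<otimes> inv a \<in> L" if L: "cofinite_normal L" for L
    proof -
      obtain l c where l: "l \<in> L" and c: "c \<in> carrier G" "c \<otimes> a = a \<otimes> c" and xlc: "x = l \<otimes> c"
        using x L a by (auto simp: profinite_closure_def set_mult_def centralizer_def)
      have lc: "l \<in> carrier G" using l cofinite_normalD(2)[OF L] by (simp add: subgroup.mem_carrier)
      have "x \<otimes> a \<otimes> inv x \<otimes> inv a = l \<otimes> (c \<otimes> a) \<otimes> inv c \<otimes> inv l \<otimes> inv a"
        using lc c(1) ac by (simp add: xlc group_word_simps)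
      also have "\<dots> = l \<otimes> (a \<otimes> inv l \<otimes> inv a)"
        unfolding c(2) using lc c(1) ac by (simp add: group_word_simps)
      finally have "x \<otimes> a \<otimes> inv x \<otimes> inv a = l \<otimes> (a \<otimes> inv l \<otimes> inv a)" .
      moreover have "a \<otimes> inv l \<otimes> inv a \<in> L"
        using normal.inv_op_closed2[OF cofinite_normalD(1)[OF L] ac] l cofinite_normalD(2)[OF L]
        by (simp add: subgroup.m_inv_closed)
      ultimately show ?thesis using l cofinite_normalD(2)[OF L] by (simp add: subgroup.m_closed)
    qed
    moreover have "x \<otimes> a \<otimes> inv x \<otimes> inv a \<in> carrier G" using xc ac by simp
    ultimately have "x \<otimes> a \<otimes> inv x \<otimes> inv a = \<one>"
      using rf unfolding residually_finite_group_def cofinite_normal_def by blast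
    then show ?thesis using xc ac by (simp add: commutator_eq_one_iff)
  qed
  then show "x \<in> centralizer G A" using xc by (simp add: centralizer_def)
qed

text \<open>The conjugate \<open>x^-1 a x\<close> depends only on the right coset of the centralizer
  of \<open>a\<close> that contains \<open>x\<close>, so conjugacy classes in \<open>A\<close> are
  finite.\<close>

lemma amenable_if_finite_index_centralizers:
  assumes A: "subgroup A G"
    and fi: "\<And>a. a \<in> A \<Longrightarrow> finite_index_subgroup G A (A \<inter> centralizer G {a})"
  shows "amenable_group (G\<lparr>carrier := A\<rparr>)"
proof -
  interpret A: group "G\<lparr>carrier := A\<rparr>" using A by (simp add: subgroup.subgroup_is_group)
  show ?thesis
  proof (rule A.amenable_group_if_finite_conjugacy_classes)
    fix a assume "a \<in> carrier (G\<lparr>carrier := A\<rparr>)"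
    then have a: "a \<in> A" by simp
    obtain T where T: "finite T" "T \<subseteq> A" "A \<subseteq> (A \<inter> centralizer G {a}) <#> T"
      by (rule finite_index_subgroup_transversal[OF A fi[OF a]])
    have "inv x \<otimes> a \<otimes> x \<in> (\<lambda>t. inv t \<otimes> a \<otimes> t) ` T" if xA: "x \<in> A" for x
    proof -
      obtain c t where c: "c \<in> carrier G" "c \<otimes> a = a \<otimes> c" and t: "t \<in> T" and x: "x = c \<otimes> t"
        using subsetD[OF T(3) xA] by (auto simp: set_mult_def centralizer_def)
      have car: "t \<in> carrier G" "a \<in> carrier G" using t T(2) a A by (auto simp: subgroup.mem_carrier)
      have "inv x \<otimes> a \<otimes> x = inv t \<otimes> inv c \<otimes> (a \<otimes> c) \<otimes> t"
        using c(1) car by (simp add: x group_word_simps)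
      also have "\<dots> = inv t \<otimes> a \<otimes> t"
        unfolding c(2)[symmetric] using c(1) car by (simp add: group_word_simps)
      finally have "inv x \<otimes> a \<otimes> x = inv t \<otimes> a \<otimes> t" .
      then show ?thesis using t by auto
    qed
    then have "(\<lambda>x. inv x \<otimes> a \<otimes> x) ` A \<subseteq> (\<lambda>t. inv t \<otimes> a \<otimes> t) ` T" by blast
    then have "finite ((\<lambda>x. inv x \<otimes> a \<otimes> x) ` A)" using T(1) by (meson finite_imageI finite_subset)
    moreover have "(\<lambda>x. inv\<^bsub>G\<lparr>carrier := A\<rparr>\<^esub> x \<otimes> a \<otimes> x) ` A = (\<lambda>x. inv x \<otimes> a \<otimes> x) ` A"
      using m_inv_consistent[OF A] by (intro image_cong) auto
    ultimately show "finite ((\<lambda>x. inv\<^bsub>G\<lparr>carrier := A\<rparr>\<^esub> x \<otimes>\<^bsub>G\<lparr>carrier := A\<rparr>\<^esub> a \<otimes>\<^bsub>G\<lparr>carrier := A\<rparr>\<^esub> x) `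
        carrier (G\<lparr>carrier := A\<rparr>))" by simp
  qed
qed

lemma normal_commutator_mem:
  assumes "N \<lhd> G" "n \<in> N" "x \<in> carrier G"
  shows "x \<otimes> n \<otimes> inv x \<otimes> inv n \<in> N" "n \<otimes> x \<otimes> inv n \<otimes> inv x \<in> N"
proof -
  have N: "subgroup N G" using assms(1) by (rule normal_imp_subgroup)
  have c: "n \<in> carrier G" using N assms(2) by (simp add: subgroup.mem_carrier)
  show "x \<otimes> n \<otimes> inv x \<otimes> inv n \<in> N"
    using normal.inv_op_closed2[OF assms(1,3,2)] assms(2) N
    by (simp add: subgroup.m_closed subgroup.m_inv_closed)
  have "n \<otimes> (x \<otimes> inv n \<otimes> inv x) \<in> N"
    using normal.inv_op_closed2[OF assms(1,3), of "inv n"] assms(2) N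
    by (simp add: subgroup.m_closed subgroup.m_inv_closed)
  then show "n \<otimes> x \<otimes> inv n \<otimes> inv x \<in> N" using c assms(3) by (simp add: m_assoc)
qed

lemma finite_index_centralizer_Int:
  assumes H: "commensurated H G" and N: "N \<lhd> G" "N \<inter> H = {\<one>}" and n: "n \<in> N"
  shows "finite_index_subgroup G H (H \<inter> centralizer G {n})"
proof -
  have sH: "subgroup H G" using H by (simp add: commensurated_def)
  have nc: "n \<in> carrier G"
    by (rule subgroup.mem_carrier[OF normal_imp_subgroup[OF N(1)] n])
  have "H \<inter> (n <# H #> inv n) \<subseteq> H \<inter> centralizer G {n}"
  proof
    fix h assume "h \<in> H \<inter> (n <# H #> inv n)"
    then have h: "h \<in> H" "h \<in> carrier G" "inv n \<otimes> h \<otimes> n \<in> H"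
      using nc subgroup.subset[OF sH] by (auto simp: conj_set_eq)
    \<comment> \<open>This element is a product of two members of \<open>H\<close> and also a
      commutator with \<open>inv n \<in> N\<close>; hence it lies in
      \<open>N \<inter> H\<close>.\<close>
    then have "inv n \<otimes> h \<otimes> n \<otimes> inv h \<in> H"
      using sH by (simp add: subgroup.m_closed subgroup.m_inv_closed)
    moreover have "inv n \<otimes> h \<otimes> n \<otimes> inv h \<in> N"
      using normal_commutator_mem(2)[OF N(1), of "inv n" h] n h nc normal_imp_subgroup[OF N(1)]
      by (simp add: subgroup.m_inv_closed)
    ultimately have "inv n \<otimes> h \<otimes> inv (inv n) \<otimes> inv h \<in> N \<inter> H" using nc by simp
    then have "inv n \<otimes> h \<otimes> inv (inv n) \<otimes> inv h = \<one>" using N(2) by simp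
    then have "inv n \<otimes> h = h \<otimes> inv n" using h nc by (simp only: commutator_eq_one_iff inv_closed)
    then have "n \<otimes> (inv n \<otimes> h) \<otimes> n = n \<otimes> (h \<otimes> inv n) \<otimes> n" by simp
    then have "h \<otimes> n = n \<otimes> h" using h nc by (simp add: group_word_simps)
    then show "h \<in> H \<inter> centralizer G {n}" using h by (simp add: centralizer_def)
  qed
  moreover have "finite_index_subgroup G H (H \<inter> (n <# H #> inv n))"
    using H nc by (simp add: commensurated_def)
  moreover have "subgroup (H \<inter> centralizer G {n}) G"
    using sH nc by (simp add: subgroups_Inter_pair subgroup_centralizer)
  ultimately show ?thesis
    using finite_index_subgroup_mono[OF sH] by blast
qed

section \<open>Finite index subgroups centralizing a normal subgroup\<close>

theorem finite_index_subgroup_centralizes_normal: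
  assumes fg: "finitely_generated_group G"
    and rf: "residually_finite_group G"
    and amenable: "\<And>A. A \<lhd> G \<Longrightarrow> amenable_group (G\<lparr>carrier := A\<rparr>) \<Longrightarrow> finite A"
    and N: "N \<lhd> G"
    and H: "commensurated H G"
    and NH: "N \<inter> H = {\<one>}"
  shows "\<exists>K. finite_index_subgroup G H K \<and> K \<subseteq> centralizer G N"
proof -
  define J where "J = profinite_closure H"
  have sH: "subgroup H G" using H by (simp add: commensurated_def)
  have sN: "subgroup N G" using N by (rule normal_imp_subgroup)
  have HJ: "H \<subseteq> J" unfolding J_def by (rule profinite_closure_subset[OF sH])
  have J: "commensurated J G" unfolding J_def by (rule commensurated_profinite_closure[OF H])
  then have sJ: "subgroup J G" by (simp add: commensurated_def)
  have "profinite_closure J \<subseteq> J"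
    unfolding J_def by (auto intro!: profinite_closure_idem[OF sH] simp: profinite_closure_def[of "profinite_closure H"])
  then obtain L where L: "cofinite_normal L" and M: "J \<inter> L \<lhd> G"
    using closed_commensurated_virtually_normal[OF fg J] by blast
  define A where "A = J \<inter> L \<inter> N"
  have A: "A \<lhd> G" unfolding A_def using M N by (rule normal_subgroup_intersect)
  then have sA: "subgroup A G" by (rule normal_imp_subgroup)
  \<comment> \<open>Since \<open>a \<in> N\<close>, its centralizer meets \<open>H\<close> in finite
    index. Taking closures carries this over to \<open>J\<close>, because the centralizer is closed,
    and intersecting with \<open>A \<subseteq> J\<close> restricts it to \<open>A\<close>.\<close>
  have "finite_index_subgroup G A (A \<inter> centralizer G {a})" if a: "a \<in> A" for a
  proof -
    have aN: "a \<in> N" using a by (simp add: A_def)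
    then have ac: "{a} \<subseteq> carrier G" using sN by (simp add: subgroup.mem_carrier)
    have "finite_index_subgroup G J (profinite_closure (H \<inter> centralizer G {a}))"
      unfolding J_def
      by (rule finite_index_profinite_closure[OF sH finite_index_centralizer_Int[OF H N NH aN]])
    moreover have "profinite_closure (H \<inter> centralizer G {a}) \<subseteq> J \<inter> centralizer G {a}"
      using profinite_closure_mono[of "H \<inter> centralizer G {a}" H]
        profinite_closure_mono[of "H \<inter> centralizer G {a}" "centralizer G {a}"]
        profinite_closure_centralizer[OF rf ac] by (auto simp: J_def)
    moreover have "subgroup (J \<inter> centralizer G {a}) G"
      using sJ subgroup_centralizer[OF ac] by (rule subgroups_Inter_pair)
    ultimately have "finite_index_subgroup G J (J \<inter> centralizer G {a})"
      using finite_index_subgroup_mono[OF sJ] by blast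
    then have "finite_index_subgroup G (A \<inter> J) (A \<inter> (J \<inter> centralizer G {a}))"
      by (rule finite_index_subgroup_Int_left[OF sJ sA])
    moreover have "A \<inter> J = A" "A \<inter> (J \<inter> centralizer G {a}) = A \<inter> centralizer G {a}"
      by (auto simp: A_def)
    ultimately show ?thesis by simp
  qed
  then have "finite A"
    by (intro amenable[OF A] amenable_if_finite_index_centralizers[OF sA])
  \<comment> \<open>Each of the finitely many nontrivial elements of \<open>A\<close> is avoided by
    some neighbourhood, hence all of them by a common one.\<close>
  have "\<exists>L'. cofinite_normal L' \<and> (\<forall>a\<in>A - {\<one>}. a \<notin> L')"
    using \<open>finite A\<close> rf subgroup.mem_carrier[OF sA]
    by (intro cofinite_normal_common) (auto simp: residually_finite_group_def cofinite_normal_def)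
  then obtain L' where L': "cofinite_normal L'" and disj: "\<forall>a\<in>A - {\<one>}. a \<notin> L'" by blast
  have LL': "cofinite_normal (L \<inter> L')" using L L' by (rule cofinite_normal_Int)
  have "finite_index_subgroup G H (H \<inter> (L \<inter> L'))"
    using finite_index_subgroup_Int_left[OF subgroup_self sH, of "L \<inter> L'"] LL' subgroup.subset[OF sH]
    by (simp add: cofinite_normal_def Int_absorb2)
  moreover have "H \<inter> (L \<inter> L') \<subseteq> centralizer G N"
  proof
    fix k assume k: "k \<in> H \<inter> (L \<inter> L')"
    have kc: "k \<in> carrier G" using k sH by (simp add: subgroup.mem_carrier)
    \<comment> \<open>From \<open>k \<in> J \<inter> L\<close>, \<open>n \<in> N\<close> and
      normality of both subgroups, the commutator lies in \<open>A\<close>. From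
      \<open>k \<in> L'\<close> it also lies in \<open>L'\<close>, which meets \<open>A\<close> only
      in \<open>\<one>\<close>.\<close>
    have "k \<otimes> n = n \<otimes> k" if n: "n \<in> N" for n
    proof -
      have nc: "n \<in> carrier G" using n sN by (simp add: subgroup.mem_carrier)
      let ?c = "k \<otimes> n \<otimes> inv k \<otimes> inv n"
      have "?c \<in> A"
        using normal_commutator_mem(2)[OF M, of k n] normal_commutator_mem(1)[OF N n kc] k HJ nc
        by (auto simp: A_def)
      moreover have "?c \<in> L'"
        using normal_commutator_mem(2)[OF cofinite_normalD(1)[OF L'], of k n] k nc by auto
      ultimately have "?c = \<one>" using disj by blast
      then show ?thesis using kc nc by (simp add: commutator_eq_one_iff)
    qed
    then show "k \<in> centralizer G N" using kc by (simp add: centralizer_def)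
  qed
  ultimately show ?thesis by blast
qed

end

theorem corollary18:
  fixes G :: "('a, 'b) monoid_scheme" and N H :: "'a set"
  assumes "group G"
    and "finitely_generated_group G"
    and "residually_finite_group G"
    and "\<And>A. A \<lhd> G \<Longrightarrow> amenable_group (G\<lparr>carrier := A\<rparr>) \<Longrightarrow> finite A"
    and "N \<lhd> G"
    and "commensurated H G"
    and "N \<inter> H = {\<one>\<^bsub>G\<^esub>}"
  shows "\<exists>K. finite_index_subgroup G H K \<and> K \<subseteq> centralizer G N"
  using assms by (rule group.finite_index_subgroup_centralizes_normal)

end
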